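(* Let $\pi_1=\pi_2=\pi$ and $c>0$. Let the problem of minimization of $R(\psi)=R(\psi;c)$ be truncatable, and let $\mathscr F$ be the set of all stopping rules. Then a stopping rule $\psi$ satisfies $$R(\psi)=\inf_{\psi'\in\mathscr F}R(\psi')$$ if and only if $$I_{\{R_n<q_n\}}\leq\psi_n\leq I_{\{R_n\leq q_n\}}$$ $P^\pi$-almost surely on $T_n^\psi$ for all $n=1,2,\dots$, where $R_n=R_n(X_1,\dots,X_n)$ is the posterior risk and $q_n=q_n(X_1,\dots,X_n)$ is the limit function defined in the context.
   Context: Setting. $X_1,X_2,\dots$ is a discrete-time stochastic process whose distribution $P_\theta$ (expectation $E_\theta$) depends on an unknown parameter $\theta\in\Theta$. For every $n\ge1$, $(X_1,\dots,X_n)$ has under $P_\theta$ a density $f_\theta^n=f_\theta^n(x_1,\dots,x_n)$ with respect to the product measure $\mu^n=\mu\otimes\cdots\otimes\mu$, where $\mu$ is a $\sigma$-finite measure; $f_\theta^n(x_1,\dots,x_n)$ is measurable in $(\theta,x_1,\dots,x_n)$. A (randomized) stopping rule is a sequence $\psi=(\psi_1,\psi_2,\dots)$ of measurable functions $\psi_n=\psi_n(x_1,\dots,x_n)\in[0,1]$; a decision function based on $n$ observations is a measurable function $\delta_n=\delta_n(x_1,\dots,x_n)\in\mathscr D$ ($\mathscr D$ is the decision space). Under an expectation or probability sign a function $F_n$ of $(x_1,\dots,x_n)$ is evaluated at $(X_1,\dots,X_n)$. The randomized stopping time $\tau_\psi$ satisfies: $\tau_\psi=n$ iff $U_1>\psi_1(X_1),\dots,U_{n-1}>\psi_{n-1}(X_1,\dots,X_{n-1})$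 and $U_n\le\psi_n(X_1,\dots,X_n)$, where $U_1,U_2,\dots$ are i.i.d. uniform on $[0,1]$, independent of $(X_1,X_2,\dots)$. $w(\theta,d)\ge0$ is a loss function measurable in $(\theta,d)\in\Theta\times\mathscr D$; $\pi$ is a probability measure on $\Theta$ (the prior). For every $n\ge1$ it is assumed that there is a (Bayesian) decision function $\delta_n^B$ such that for any $d\in\mathscr D$ $$\int w(\theta,d)f_\theta^n\,d\pi(\theta)\ge l_n:=\int w(\theta,\delta_n^B)f_\theta^n\,d\pi(\theta)$$ for $\mu^n$-almost all $(x_1,\dots,x_n)$. It is assumed that $\int l_1\,d\mu<\infty$. Notation: $f^n=f^n(x_1,\dots,x_n)=\int_\Theta f_\theta^n\,d\pi(\theta)$; $P^\pi$ and $E^\pi$ denote probability and expectation with respect to the family of finite-dimensional densities $f^n$, $n\ge1$; $s_n^\psi=(1-\psi_1)\cdots(1-\psi_{n-1})\psi_n$; $t_n^\psi=(1-\psi_1)\cdots(1-\psi_{n-1})$ with $t_1^\psi\equiv1$; $T_n^\psi=\{(x_1,\dots,x_n):t_n^\psi>0\}$; $P^\pi(\tau_\psi<\infty)=\sum_{n\ge1}\int E_\theta s_n^\psi\,d\pi(\theta)$. $I_A$ is the indicator of $A$. Risk of a stopping rule: for fixed $c>0$, $$R(\psi)=R(\psi;c)=\begin{cases}\displaystyle\sum_{n=1}^\infty\int s_n^\psi(cnf^n+l_n)\,d\mu^n,&\text{if }P^{\pi}(\tau_\psi<\infty)=1,\\ \infty,&\text{otherwise,}\end{cases}$$ and the risk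 of $\psi$ truncated at $N$ is $R_N(\psi)=\sum_{n=1}^{N-1}\int s_n^\psi(cnf^n+l_n)\,d\mu^n+\int t_N^\psi(cNf^N+l_N)\,d\mu^N$ (not to be confused with the posterior risk below). The problem of minimization of $R(\psi)$ is called truncatable if $R_N(\psi)\to R(\psi)$ as $N\to\infty$ for every stopping rule $\psi$. Posterior risk: $$R_n=R_n(x_1,\dots,x_n)=\frac{l_n}{f^n}=\frac{\int_\Theta f_\theta^nw(\theta,\delta_n^B)\,d\pi(\theta)}{\int_\Theta f_\theta^n\,d\pi(\theta)}.$$ Let $v_N^N=R_N(X_1,\dots,X_N)$ and recursively, for $n=N-1,N-2,\dots,1$, $$v_n^N(X_1,\dots,X_n)=\min\{R_n(X_1,\dots,X_n),q_n^N(X_1,\dots,X_n)\},\qquad q_n^N(X_1,\dots,X_n)=c+E^\pi\{v_{n+1}^N\mid X_1,\dots,X_n\},$$ where $$E^\pi\{v_{n+1}^N\mid x_1,\dots,x_n\}=\int\frac{v_{n+1}^N(x_1,\dots,x_{n+1})f^{n+1}(x_1,\dots,x_{n+1})}{f^n(x_1,\dots,x_n)}\,d\mu(x_{n+1}).$$ Finally $v_n=\lim_{N\to\infty}v_n^N$ and $q_n=\lim_{N\to\infty}q_n^N$, $n=1,2,\dots$. *)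

theory Defs
  imports "HOL-Probability.Probability"
begin

text \<open>
  A vector \<open>(x\<^sub>1, \<dots>, x\<^sub>n)\<close> of observations is an element of the product space
  \<open>\<Pi>\<^sub>M i\<in>{1..n}. \<mu>\<close>; stage numbers start at \<open>1\<close>. Risks, losses and averages over the
  prior take values in \<open>ennreal\<close>, so that no integrability has to be presupposed.
  The measures in \<open>samples\<close> and \<open>decisions\<close> are used only as measurable spaces.
\<close>

record ('p, 'w, 'x, 'd) sequential_problem =
  prior :: "'p measure"
  samples :: "'w measure"
  law :: "'p \<Rightarrow> 'w measure"
  obs :: "nat \<Rightarrow> 'w \<Rightarrow> 'x"
  ref_measure :: "'x measure"
  dens :: "nat \<Rightarrow> 'p \<Rightarrow> (nat \<Rightarrow> 'x) \<Rightarrow> real"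
  decisions :: "'d measure"
  loss :: "'p \<Rightarrow> 'd \<Rightarrow> real"
  bayes_decision :: "nat \<Rightarrow> (nat \<Rightarrow> 'x) \<Rightarrow> 'd"

definition obs_measure :: "('p, 'w, 'x, 'd) sequential_problem \<Rightarrow> nat \<Rightarrow> (nat \<Rightarrow> 'x) measure"
  where "obs_measure B n = (\<Pi>\<^sub>M i\<in>{1..n}. ref_measure B)"

definition obs_vector :: "('p, 'w, 'x, 'd) sequential_problem \<Rightarrow> nat \<Rightarrow> 'w \<Rightarrow> nat \<Rightarrow> 'x"
  where "obs_vector B n \<omega> = (\<lambda>i\<in>{1..n}. obs B i \<omega>)"

text \<open>\<open>f\<^sup>n\<close>, \<open>l\<^sub>n\<close> and the posterior risk \<open>R\<^sub>n = l\<^sub>n / f\<^sup>n\<close>\<close>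

definition mix_dens :: "('p, 'w, 'x, 'd) sequential_problem \<Rightarrow> nat \<Rightarrow> (nat \<Rightarrow> 'x) \<Rightarrow> ennreal"
  where "mix_dens B n x = (\<integral>\<^sup>+\<theta>. ennreal (dens B n \<theta> x) \<partial>prior B)"

definition bayes_loss :: "('p, 'w, 'x, 'd) sequential_problem \<Rightarrow> nat \<Rightarrow> (nat \<Rightarrow> 'x) \<Rightarrow> ennreal"
  where "bayes_loss B n x =
    (\<integral>\<^sup>+\<theta>. ennreal (loss B \<theta> (bayes_decision B n x) * dens B n \<theta> x) \<partial>prior B)"

definition post_risk :: "('p, 'w, 'x, 'd) sequential_problem \<Rightarrow> nat \<Rightarrow> (nat \<Rightarrow> 'x) \<Rightarrow> ennreal"
  where "post_risk B n x = bayes_loss B n x / mix_dens B n x"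

text \<open>The law of \<open>(X\<^sub>1, \<dots>, X\<^sub>n)\<close> under \<open>P\<^sup>\<pi>\<close>\<close>

definition mix_law :: "('p, 'w, 'x, 'd) sequential_problem \<Rightarrow> nat \<Rightarrow> (nat \<Rightarrow> 'x) measure"
  where "mix_law B n = density (obs_measure B n) (mix_dens B n)"

locale bayes_sequential_problem =
  fixes B :: "('p, 'w, 'x, 'd) sequential_problem"
  assumes prior_prob: "prob_space (prior B)"
    and ref_sigma_finite: "sigma_finite_measure (ref_measure B)"
    and law_prob: "\<And>\<theta>. \<theta> \<in> space (prior B) \<Longrightarrow> prob_space (law B \<theta>)"
    and law_sets: "\<And>\<theta>. \<theta> \<in> space (prior B) \<Longrightarrow> sets (law B \<theta>) = sets (samples B)"
    and obs_measurable: "\<And>n. 1 \<le> n \<Longrightarrow> obs B n \<in> samples B \<rightarrow>\<^sub>M ref_measure B"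
    and dens_measurable: "\<And>n. 1 \<le> n \<Longrightarrow>
      (\<lambda>(\<theta>, x). dens B n \<theta> x) \<in> borel_measurable (prior B \<Otimes>\<^sub>M obs_measure B n)"
    and dens_nonneg: "\<And>n \<theta> x. 1 \<le> n \<Longrightarrow> \<theta> \<in> space (prior B) \<Longrightarrow>
      x \<in> space (obs_measure B n) \<Longrightarrow> 0 \<le> dens B n \<theta> x"
    and obs_distributed: "\<And>n \<theta>. 1 \<le> n \<Longrightarrow> \<theta> \<in> space (prior B) \<Longrightarrow>
      distributed (law B \<theta>) (obs_measure B n) (obs_vector B n) (\<lambda>x. ennreal (dens B n \<theta> x))"
    and loss_measurable:
      "(\<lambda>(\<theta>, d). loss B \<theta> d) \<in> borel_measurable (prior B \<Otimes>\<^sub>M decisions B)"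
    and loss_nonneg: "\<And>\<theta> d. \<theta> \<in> space (prior B) \<Longrightarrow> d \<in> space (decisions B) \<Longrightarrow>
      0 \<le> loss B \<theta> d"
    and bayes_decision_measurable: "\<And>n. 1 \<le> n \<Longrightarrow>
      bayes_decision B n \<in> obs_measure B n \<rightarrow>\<^sub>M decisions B"
    and bayes_decision_optimal: "\<And>n d. 1 \<le> n \<Longrightarrow> d \<in> space (decisions B) \<Longrightarrow>
      AE x in obs_measure B n.
        (\<integral>\<^sup>+\<theta>. ennreal (loss B \<theta> d * dens B n \<theta> x) \<partial>prior B) \<ge> bayes_loss B n x"
    and bayes_loss_integrable: "(\<integral>\<^sup>+x. bayes_loss B 1 x \<partial>obs_measure B 1) < \<infinity>"

definition stopping_rules ::
    "('p, 'w, 'x, 'd) sequential_problem \<Rightarrow> (nat \<Rightarrow> (nat \<Rightarrow> 'x) \<Rightarrow> real) set"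
  where "stopping_rules B = {\<psi>. \<forall>n\<ge>1. \<psi> n \<in> borel_measurable (obs_measure B n) \<and>
    (\<forall>x\<in>space (obs_measure B n). 0 \<le> \<psi> n x \<and> \<psi> n x \<le> 1)}"

text \<open>\<open>t\<^sub>n\<close> and \<open>s\<^sub>n\<close> as functions of \<open>(x\<^sub>1, \<dots>, x\<^sub>n)\<close>\<close>

definition cont_prob :: "(nat \<Rightarrow> (nat \<Rightarrow> 'x) \<Rightarrow> real) \<Rightarrow> nat \<Rightarrow> (nat \<Rightarrow> 'x) \<Rightarrow> real"
  where "cont_prob \<psi> n x = (\<Prod>k\<in>{1..<n}. 1 - \<psi> k (restrict x {1..k}))"

definition stop_prob :: "(nat \<Rightarrow> (nat \<Rightarrow> 'x) \<Rightarrow> real) \<Rightarrow> nat \<Rightarrow> (nat \<Rightarrow> 'x) \<Rightarrow> real"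
  where "stop_prob \<psi> n x = cont_prob \<psi> n x * \<psi> n x"

definition cont_set ::
    "('p, 'w, 'x, 'd) sequential_problem \<Rightarrow> (nat \<Rightarrow> (nat \<Rightarrow> 'x) \<Rightarrow> real) \<Rightarrow> nat \<Rightarrow> (nat \<Rightarrow> 'x) set"
  where "cont_set B \<psi> n = {x \<in> space (obs_measure B n). cont_prob \<psi> n x > 0}"

text \<open>\<open>P\<^sup>\<pi>(\<tau>\<^sub>\<psi> < \<infinity>)\<close>; the summand \<open>n\<close> belongs to stage \<open>n + 1\<close>\<close>

definition mix_stop_prob ::
    "('p, 'w, 'x, 'd) sequential_problem \<Rightarrow> (nat \<Rightarrow> (nat \<Rightarrow> 'x) \<Rightarrow> real) \<Rightarrow> ennreal"
  where "mix_stop_prob B \<psi> =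
    (\<Sum>n. \<integral>\<^sup>+\<theta>. (\<integral>\<^sup>+\<omega>. ennreal (stop_prob \<psi> (Suc n) (obs_vector B (Suc n) \<omega>)) \<partial>law B \<theta>) \<partial>prior B)"

definition stage_cost ::
    "('p, 'w, 'x, 'd) sequential_problem \<Rightarrow> real \<Rightarrow> nat \<Rightarrow> (nat \<Rightarrow> 'x) \<Rightarrow> ennreal"
  where "stage_cost B c n x = ennreal (c * real n) * mix_dens B n x + bayes_loss B n x"

definition risk ::
    "('p, 'w, 'x, 'd) sequential_problem \<Rightarrow> real \<Rightarrow> (nat \<Rightarrow> (nat \<Rightarrow> 'x) \<Rightarrow> real) \<Rightarrow> ennreal"
  where "risk B c \<psi> =
    (if mix_stop_prob B \<psi> = 1
     then \<Sum>n. \<integral>\<^sup>+x. ennreal (stop_prob \<psi> (Suc n) x) * stage_cost B c (Suc n) x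
            \<partial>obs_measure B (Suc n)
     else \<infinity>)"

definition trunc_risk ::
    "('p, 'w, 'x, 'd) sequential_problem \<Rightarrow> real \<Rightarrow> nat \<Rightarrow> (nat \<Rightarrow> (nat \<Rightarrow> 'x) \<Rightarrow> real) \<Rightarrow> ennreal"
  where "trunc_risk B c N \<psi> =
    (\<Sum>n\<in>{1..<N}. \<integral>\<^sup>+x. ennreal (stop_prob \<psi> n x) * stage_cost B c n x \<partial>obs_measure B n)
    + (\<integral>\<^sup>+x. ennreal (cont_prob \<psi> N x) * stage_cost B c N x \<partial>obs_measure B N)"

definition truncatable :: "('p, 'w, 'x, 'd) sequential_problem \<Rightarrow> real \<Rightarrow> bool"
  where "truncatable B c \<longleftrightarrow>
    (\<forall>\<psi>\<in>stopping_rules B. (\<lambda>N. trunc_risk B c N \<psi>) \<longlonglongrightarrow> risk B c \<psi>)"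

text \<open>\<open>E\<^sup>\<pi>{g | x\<^sub>1, \<dots>, x\<^sub>n}\<close> for a function \<open>g\<close> of \<open>n + 1\<close> observations\<close>

definition cond_exp_next ::
    "('p, 'w, 'x, 'd) sequential_problem \<Rightarrow> nat \<Rightarrow> ((nat \<Rightarrow> 'x) \<Rightarrow> ennreal) \<Rightarrow> (nat \<Rightarrow> 'x) \<Rightarrow> ennreal"
  where "cond_exp_next B n g x =
    (\<integral>\<^sup>+y. g (x(Suc n := y)) * mix_dens B (Suc n) (x(Suc n := y)) / mix_dens B n x
       \<partial>ref_measure B)"

text \<open>\<open>v\<^sub>n\<^sup>N\<close> is \<open>trunc_value B c N n\<close>; only \<open>n \<le> N\<close> is meaningful.\<close>

function trunc_value ::
    "('p, 'w, 'x, 'd) sequential_problem \<Rightarrow> real \<Rightarrow> nat \<Rightarrow> nat \<Rightarrow> (nat \<Rightarrow> 'x) \<Rightarrow> ennreal"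
  where "trunc_value B c N n =
    (if n < N
     then (\<lambda>x. min (post_risk B n x)
                   (ennreal c + cond_exp_next B n (trunc_value B c N (Suc n)) x))
     else post_risk B n)"
  by pat_completeness auto
termination
  by (relation "Wellfounded.measure (\<lambda>(B, c, N, n). N - n)") auto

declare trunc_value.simps [simp del]

definition trunc_cont_value ::
    "('p, 'w, 'x, 'd) sequential_problem \<Rightarrow> real \<Rightarrow> nat \<Rightarrow> nat \<Rightarrow> (nat \<Rightarrow> 'x) \<Rightarrow> ennreal"
  where "trunc_cont_value B c N n x =
    ennreal c + cond_exp_next B n (trunc_value B c N (Suc n)) x"

definition cont_value ::
    "('p, 'w, 'x, 'd) sequential_problem \<Rightarrow> real \<Rightarrow> nat \<Rightarrow> (nat \<Rightarrow> 'x) \<Rightarrow> ennreal"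
  where "cont_value B c n x = lim (\<lambda>N. trunc_cont_value B c N n x)"

end

theory Submission
  imports Defs
begin

text \<open>
  Multiplied by \<open>f\<^sup>n\<close>, the backward recursion becomes
  \<open>V\<^sub>n\<^sup>N = min l\<^sub>n (c f\<^sup>n + \<integral> V\<^sub>n\<^sub>+\<^sub>1\<^sup>N d\<mu>)\<close>, decreasing in \<open>N\<close> with limit \<open>V\<^sub>n = min l\<^sub>n W\<^sub>n\<close>, where
  \<open>W\<^sub>n = c f\<^sup>n + lim \<integral> V\<^sub>n\<^sub>+\<^sub>1\<^sup>N d\<mu> = q\<^sub>n f\<^sup>n\<close>. Let \<open>J\<^sub>n(h)\<close> be the cost of \<open>\<psi>\<close> when stage \<open>n\<close>, once
  reached, ends the experiment with loss \<open>h\<close>. Since \<open>p a + (1 - p) b \<ge> min a b\<close>,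
  \<open>J\<^sub>1(V\<^sub>1\<^sup>N) \<le> \<dots> \<le> J\<^sub>N(V\<^sub>N\<^sup>N) = R\<^sub>N(\<psi>)\<close>, and truncatability gives \<open>R(\<psi>) \<ge> V := J\<^sub>1(V\<^sub>1)\<close>.

  If \<open>\<psi>\<^sub>n l\<^sub>n + (1 - \<psi>\<^sub>n) W\<^sub>n = V\<^sub>n\<close> on \<open>t\<^sub>n > 0\<close> for all \<open>n\<close>, then \<open>J\<^sub>n(V\<^sub>n)\<close> is decreasing, hence
  \<open>c n \<integral> t\<^sub>n f\<^sup>n \<le> V\<close>, so that \<open>\<psi>\<close> stops almost surely and \<open>R(\<psi>) \<le> V\<close>. Such a rule exists, so
  the minimal risk is \<open>V\<close>. Conversely \<open>R(\<psi>) = V\<close> forces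
  \<open>J\<^sub>n(\<psi>\<^sub>n l\<^sub>n + (1 - \<psi>\<^sub>n) W\<^sub>n) \<le> V \<le> J\<^sub>n(V\<^sub>n)\<close> with finite right-hand side, and therefore equality of
  the integrands almost everywhere. Finally, \<open>p a + (1 - p) b = min a b\<close> means \<open>p = 1\<close> if \<open>a < b\<close>
  and \<open>p = 0\<close> if \<open>a > b\<close>.
\<close>

subsection \<open>Convex combinations and integrals of extended reals\<close>

text \<open>The nonnegative difference has integral zero; the subtraction is legitimate because the
  smaller integral is finite. This turns equality of risks into a pointwise condition.\<close>

lemma AE_eq_of_nn_integral_le:
  fixes f g :: "'a \<Rightarrow> ennreal"
  assumes [measurable]: "f \<in> borel_measurable M" "g \<in> borel_measurable M"
    and le: "AE x in M. g x \<le> f x"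
    and int: "(\<integral>\<^sup>+x. f x \<partial>M) \<le> (\<integral>\<^sup>+x. g x \<partial>M)" "(\<integral>\<^sup>+x. g x \<partial>M) < \<infinity>"
  shows "AE x in M. f x = g x"
proof -
  have "(\<integral>\<^sup>+x. f x - g x \<partial>M) = (\<integral>\<^sup>+x. f x \<partial>M) - (\<integral>\<^sup>+x. g x \<partial>M)"
    using int le by (intro nn_integral_diff) auto
  also have "\<dots> = 0"
    using int by (simp add: diff_eq_0_iff_ennreal)
  finally have "AE x in M. f x - g x = 0"
    by (subst (asm) nn_integral_0_iff_AE) auto
  with le show ?thesis
    by eventually_elim (auto simp: diff_eq_0_iff_ennreal)
qed

context
  fixes a b :: ennreal and p :: real
  assumes p: "0 \<le> p" "p \<le> 1"
begin

lemma min_le_convex_ennreal: "min a b \<le> ennreal p * a + ennreal (1 - p) * b"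
proof -
  have "min a b = (ennreal p + ennreal (1 - p)) * min a b"
    using p by (subst ennreal_plus[symmetric]) auto
  also have "\<dots> \<le> ennreal p * a + ennreal (1 - p) * b"
    unfolding distrib_right by (intro add_mono mult_left_mono) auto
  finally show ?thesis .
qed

lemma convex_eq_min_ennreal_iff:
  "ennreal p * a + ennreal (1 - p) * b = min a b \<longleftrightarrow> (a < b \<longrightarrow> p = 1) \<and> (b < a \<longrightarrow> p = 0)"
proof -
  \<comment> \<open>Used twice, the second time with the arguments swapped and \<open>1 - p\<close>
    in place of \<open>p\<close>.\<close>
  have strict: "min u v < ennreal q * u + ennreal (1 - q) * v"
    if "u < v" "q \<noteq> 1" "0 \<le> q" "q \<le> 1" for u v q
  proof -
    have "u = ennreal q * u + ennreal (1 - q) * u"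
      using that by (subst distrib_right[symmetric], subst ennreal_plus[symmetric]) auto
    moreover have "ennreal (1 - q) * u < ennreal (1 - q) * v"
      using that by (intro ennreal_mult_strict_left_mono) (auto simp: ennreal_less_zero_iff)
    \<comment> \<open>Since \<open>u < v\<close>, the value \<open>u\<close> is finite and this
      summand can be cancelled, even if \<open>v\<close> is infinite.\<close>
    moreover have "ennreal q * u < top"
      using that by (auto simp: ennreal_mult_less_top intro: less_le_trans)
    ultimately have "u < ennreal q * u + ennreal (1 - q) * v"
      by (metis ennreal_add_left_cancel_less less_irrefl infinity_ennreal_def)
    with that show ?thesis
      by (simp add: min_absorb1 less_imp_le)
  qed
  consider "a < b" | "a = b" | "b < a" by force
  then show ?thesis
  proof cases
    case 1
    then show ?thesis
      using strict[of a b p] p by (cases "p = 1") (auto simp: min_absorb1 less_imp_le)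
  next
    case 2
    have "ennreal p * a + ennreal (1 - p) * a = a"
      using p by (subst distrib_right[symmetric], subst ennreal_plus[symmetric]) auto
    with 2 show ?thesis by simp
  next
    case 3
    then show ?thesis
      using strict[of b a "1 - p"] p
      by (cases "p = 0") (auto simp: min_absorb2 min_absorb1 less_imp_le add.commute)
  qed
qed

text \<open>This brings the two-sided bound into the form of the right-hand side of
  \<open>convex_eq_min_ennreal_iff\<close>.\<close>

lemma indicator_bounds_iff:
  "(indicat_real {y. r y < q y} x \<le> p \<and> p \<le> indicat_real {y. r y \<le> q y} x) \<longleftrightarrow>
    (r x < q x \<longrightarrow> p = 1) \<and> (q x < (r x :: ennreal) \<longrightarrow> p = 0)"
  using p by (cases "r x" "q x" rule: linorder_cases) auto

end

subsection \<open>The mixed densities\<close>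

context bayes_sequential_problem
begin

sublocale prior: prob_space "prior B"
  by (rule prior_prob)

sublocale ref: sigma_finite_measure "ref_measure B"
  by (rule ref_sigma_finite)

sublocale ref_prod: product_sigma_finite "\<lambda>_::nat. ref_measure B"
  by standard

section \<open>Product spaces and the appending of one observation\<close>

lemma sigma_finite_obs: "sigma_finite_measure (obs_measure B n)"
  unfolding obs_measure_def by (rule ref_prod.sigma_finite) simp

lemma obs_measure_Suc: "obs_measure B (Suc n) = (\<Pi>\<^sub>M i\<in>insert (Suc n) {1..n}. ref_measure B)"
  by (simp add: obs_measure_def atLeastAtMostSuc_conv)

lemma measurable_append[measurable]:
  "(\<lambda>(x, y). x(Suc n := y)) \<in> obs_measure B n \<Otimes>\<^sub>M ref_measure B \<rightarrow>\<^sub>M obs_measure B (Suc n)"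
  unfolding obs_measure_Suc unfolding obs_measure_def by measurable

lemma restrict_obs: "x \<in> space (obs_measure B n) \<Longrightarrow> restrict x {1..n} = x"
  by (auto simp: obs_measure_def space_PiM PiE_restrict)

lemma restrict_obs_space:
  "n \<le> m \<Longrightarrow> x \<in> space (obs_measure B m) \<Longrightarrow> restrict x {1..n} \<in> space (obs_measure B n)"
  by (auto simp: obs_measure_def space_PiM PiE_iff)

lemma restrict_append:
  "k \<le> n \<Longrightarrow> restrict (x(Suc n := y)) {1..k} = restrict x {1..k}"
  by (auto simp: fun_eq_iff)

lemma nn_integral_obs_Suc:
  assumes "h \<in> borel_measurable (obs_measure B (Suc n))"
  shows "(\<integral>\<^sup>+x. h x \<partial>obs_measure B (Suc n)) =
    (\<integral>\<^sup>+x. (\<integral>\<^sup>+y. h (x(Suc n := y)) \<partial>ref_measure B) \<partial>obs_measure B n)"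
  using assms unfolding obs_measure_Suc
  by (subst ref_prod.product_nn_integral_insert) (auto simp: obs_measure_def)

lemma borel_measurable_nn_integral_append[measurable]:
  assumes [measurable]: "h \<in> borel_measurable (obs_measure B (Suc n))"
  shows "(\<lambda>x. \<integral>\<^sup>+y. h (x(Suc n := y)) \<partial>ref_measure B) \<in> borel_measurable (obs_measure B n)"
proof -
  have "(\<lambda>(x, y). h (x(Suc n := y))) = (\<lambda>p. h ((\<lambda>(x, y). x(Suc n := y)) p))"
    by auto
  also have "\<dots> \<in> borel_measurable (obs_measure B n \<Otimes>\<^sub>M ref_measure B)"
    by measurable
  finally show ?thesis
    by (rule ref.borel_measurable_nn_integral)
qed

lemma measurable_append_const[measurable]:
  assumes "x \<in> space (obs_measure B n)"
  shows "(\<lambda>y. x(Suc n := y)) \<in> ref_measure B \<rightarrow>\<^sub>M obs_measure B (Suc n)"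
  using measurable_Pair2[OF measurable_append assms] by simp

text \<open>The property may fail to be measurable, so Tonelli is applied to a measurable null set
  covering its exceptions.\<close>

lemma AE_obs_Suc:
  assumes "AE z in obs_measure B (Suc n). P z"
  shows "AE x in obs_measure B n. AE y in ref_measure B. P (x(Suc n := y))"
proof -
  from assms obtain N where N: "N \<in> null_sets (obs_measure B (Suc n))"
    and P: "\<And>z. z \<in> space (obs_measure B (Suc n)) - N \<Longrightarrow> P z"
    by (auto simp: eventually_ae_filter)
  have [measurable]: "N \<in> sets (obs_measure B (Suc n))"
    using N by auto
  have "(\<integral>\<^sup>+x. (\<integral>\<^sup>+y. indicator N (x(Suc n := y)) \<partial>ref_measure B) \<partial>obs_measure B n) = 0"
    using N by (subst nn_integral_obs_Suc[symmetric]) auto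
  then have "AE x in obs_measure B n. (\<integral>\<^sup>+y. indicator N (x(Suc n := y)) \<partial>ref_measure B) = (0::ennreal)"
    by (subst (asm) nn_integral_0_iff_AE) auto
  then show ?thesis
  proof (rule AE_mp, intro AE_I2[where M="obs_measure B n"] impI)
    fix x assume x[measurable]: "x \<in> space (obs_measure B n)"
      and "(\<integral>\<^sup>+y. indicator N (x(Suc n := y)) \<partial>ref_measure B) = (0::ennreal)"
    then have "AE y in ref_measure B. indicator N (x(Suc n := y)) = (0::ennreal)"
      by (subst (asm) nn_integral_0_iff_AE) auto
    then show "AE y in ref_measure B. P (x(Suc n := y))"
    proof (rule AE_mp, intro AE_I2 impI)
      fix y assume "y \<in> space (ref_measure B)" "indicator N (x(Suc n := y)) = (0::ennreal)"
      with measurable_space[OF measurable_append_const[OF x]] show "P (x(Suc n := y))"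
        by (intro P) (auto simp: indicator_def split: if_splits)
    qed
  qed
qed

section \<open>Averages over the prior\<close>

context
  fixes n :: nat
  assumes n: "1 \<le> n"
begin

lemma dens_measurable_swap[measurable]:
  "(\<lambda>(x, \<theta>). dens B n \<theta> x) \<in> borel_measurable (obs_measure B n \<Otimes>\<^sub>M prior B)"
  using measurable_compose[OF measurable_pair_swap' dens_measurable[OF n]]
  by (simp add: case_prod_unfold)

lemma loss_dens_measurable[measurable]:
  "(\<lambda>(x, \<theta>). loss B \<theta> (bayes_decision B n x) * dens B n \<theta> x)
    \<in> borel_measurable (obs_measure B n \<Otimes>\<^sub>M prior B)"
proof -
  have [measurable]: "bayes_decision B n \<in> obs_measure B n \<rightarrow>\<^sub>M decisions B"
    by (rule bayes_decision_measurable[OF n])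
  have "(\<lambda>p. (\<lambda>(\<theta>, d). loss B \<theta> d) (snd p, bayes_decision B n (fst p)))
      \<in> borel_measurable (obs_measure B n \<Otimes>\<^sub>M prior B)"
    by (rule measurable_compose[OF _ loss_measurable]) measurable
  then show ?thesis
    using dens_measurable_swap by (auto simp: case_prod_unfold)
qed

lemma mix_dens_measurable[measurable]: "mix_dens B n \<in> borel_measurable (obs_measure B n)"
  unfolding mix_dens_def[abs_def]
  using dens_measurable_swap
  by (intro prior.borel_measurable_nn_integral) (auto simp: case_prod_unfold)

lemma bayes_loss_measurable[measurable]: "bayes_loss B n \<in> borel_measurable (obs_measure B n)"
  unfolding bayes_loss_def[abs_def]
  using loss_dens_measurable
  by (intro prior.borel_measurable_nn_integral) (auto simp: case_prod_unfold)

text \<open>A nonnegative density with prior mean zero vanishes for almost every parameter, and the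
  weighted loss vanishes with it. This settles the points where the posterior risk is a quotient
  \<open>0 / 0\<close>.\<close>

lemma mix_dens_eq_0_imp_bayes_loss_eq_0:
  assumes x: "x \<in> space (obs_measure B n)" and "mix_dens B n x = 0"
  shows "bayes_loss B n x = 0"
proof -
  have [measurable]: "(\<lambda>\<theta>. dens B n \<theta> x) \<in> borel_measurable (prior B)"
    using measurable_Pair2[OF dens_measurable_swap x] by simp
  have "AE \<theta> in prior B. ennreal (dens B n \<theta> x) = 0"
    using assms unfolding mix_dens_def by (subst (asm) nn_integral_0_iff_AE) auto
  then have "AE \<theta> in prior B. ennreal (loss B \<theta> (bayes_decision B n x) * dens B n \<theta> x) = 0"
    using AE_space
  proof eventually_elim
    case (elim \<theta>)
    then have "dens B n \<theta> x = 0"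
      using dens_nonneg[OF n _ x] by (auto simp: ennreal_eq_0_iff intro: antisym)
    then show ?case by simp
  qed
  then show ?thesis
    unfolding bayes_loss_def by (simp add: nn_integral_cong_AE)
qed

text \<open>Each law is replaced by its density, then Tonelli exchanges prior and observations. This
  is the only use of \<open>obs_distributed\<close>.\<close>

lemma nn_integral_law_prior:
  fixes g :: "(nat \<Rightarrow> 'x) \<Rightarrow> ennreal"
  assumes [measurable]: "g \<in> borel_measurable (obs_measure B n)"
  shows "(\<integral>\<^sup>+\<theta>. (\<integral>\<^sup>+\<omega>. g (obs_vector B n \<omega>) \<partial>law B \<theta>) \<partial>prior B) =
    (\<integral>\<^sup>+x. g x * mix_dens B n x \<partial>obs_measure B n)"
proof -
  interpret M: sigma_finite_measure "obs_measure B n"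
    by (rule sigma_finite_obs)
  interpret pair_sigma_finite "obs_measure B n" "prior B" ..
  have [measurable]: "(\<lambda>(x, \<theta>). ennreal (dens B n \<theta> x)) \<in> borel_measurable (obs_measure B n \<Otimes>\<^sub>M prior B)"
    using dens_measurable_swap by (auto simp: case_prod_unfold)
  have "(\<integral>\<^sup>+\<theta>. (\<integral>\<^sup>+\<omega>. g (obs_vector B n \<omega>) \<partial>law B \<theta>) \<partial>prior B) =
      (\<integral>\<^sup>+\<theta>. (\<integral>\<^sup>+x. ennreal (dens B n \<theta> x) * g x \<partial>obs_measure B n) \<partial>prior B)"
    by (intro nn_integral_cong distributed_nn_integral[symmetric] obs_distributed n) auto
  also have "\<dots> = (\<integral>\<^sup>+x. (\<integral>\<^sup>+\<theta>. ennreal (dens B n \<theta> x) * g x \<partial>prior B) \<partial>obs_measure B n)"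
    by (rule Fubini') measurable
  also have "\<dots> = (\<integral>\<^sup>+x. g x * mix_dens B n x \<partial>obs_measure B n)"
  proof (rule nn_integral_cong)
    fix x assume x: "x \<in> space (obs_measure B n)"
    have [measurable]: "(\<lambda>\<theta>. dens B n \<theta> x) \<in> borel_measurable (prior B)"
      using measurable_Pair2[OF dens_measurable_swap x] by simp
    show "(\<integral>\<^sup>+\<theta>. ennreal (dens B n \<theta> x) * g x \<partial>prior B) = g x * mix_dens B n x"
      by (simp add: nn_integral_cmult mix_dens_def mult.commute[of _ "g x"])
  qed
  finally show ?thesis .
qed

lemma nn_integral_mix_dens: "(\<integral>\<^sup>+x. mix_dens B n x \<partial>obs_measure B n) = 1"
proof -
  have "(\<integral>\<^sup>+x. mix_dens B n x \<partial>obs_measure B n) = (\<integral>\<^sup>+\<theta>. emeasure (law B \<theta>) (space (law B \<theta>)) \<partial>prior B)"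
    using nn_integral_law_prior[of "\<lambda>_. 1"] by simp
  also have "\<dots> = (\<integral>\<^sup>+\<theta>. 1 \<partial>prior B)"
    by (intro nn_integral_cong prob_space.emeasure_space_1 law_prob)
  finally show ?thesis
    by (simp add: prior.emeasure_space_1)
qed

lemma AE_mix_dens_finite: "AE x in obs_measure B n. mix_dens B n x < top"
  using nn_integral_PInf_AE[OF mix_dens_measurable] nn_integral_mix_dens
  by (simp add: top.not_eq_extremum)

end

text \<open>Consistency of the mixed densities comes from all observations living on one sample
  space: both sides are densities of the mixed law of the first \<open>n\<close> observations, and
  sigma-finiteness makes densities unique almost everywhere.\<close>

lemma mix_dens_append:
  assumes n: "1 \<le> n"
  shows "AE x in obs_measure B n.
    (\<integral>\<^sup>+y. mix_dens B (Suc n) (x(Suc n := y)) \<partial>ref_measure B) = mix_dens B n x"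
proof -
  interpret M: sigma_finite_measure "obs_measure B n"
    by (rule sigma_finite_obs)
  have [measurable]: "mix_dens B (Suc n) \<in> borel_measurable (obs_measure B (Suc n))"
    "mix_dens B n \<in> borel_measurable (obs_measure B n)"
    using n by (auto intro: mix_dens_measurable)
  have [measurable]: "(\<lambda>x. restrict x {1..n}) \<in> obs_measure B (Suc n) \<rightarrow>\<^sub>M obs_measure B n"
    unfolding obs_measure_def by (rule measurable_restrict_subset) auto
  let ?h = "\<lambda>x. \<integral>\<^sup>+y. mix_dens B (Suc n) (x(Suc n := y)) \<partial>ref_measure B"
  have "density (obs_measure B n) ?h = density (obs_measure B n) (mix_dens B n)"
  proof (rule measure_eqI)
    fix A assume "A \<in> sets (density (obs_measure B n) ?h)"
    then have [measurable]: "A \<in> sets (obs_measure B n)" by simp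
    have "emeasure (density (obs_measure B n) (mix_dens B n)) A =
        (\<integral>\<^sup>+x. indicator A x * mix_dens B n x \<partial>obs_measure B n)"
      by (simp add: emeasure_density mult.commute)
    also have "\<dots> = (\<integral>\<^sup>+\<theta>. (\<integral>\<^sup>+\<omega>. indicator A (obs_vector B n \<omega>) \<partial>law B \<theta>) \<partial>prior B)"
      by (rule nn_integral_law_prior[OF n, symmetric]) simp
    also have "\<dots> = (\<integral>\<^sup>+\<theta>. (\<integral>\<^sup>+\<omega>. indicator A (restrict (obs_vector B (Suc n) \<omega>) {1..n}) \<partial>law B \<theta>) \<partial>prior B)"
      by (intro nn_integral_cong arg_cong[of _ _ "indicator A"]) (auto simp: obs_vector_def fun_eq_iff)
    also have "\<dots> = (\<integral>\<^sup>+x. indicator A (restrict x {1..n}) * mix_dens B (Suc n) x \<partial>obs_measure B (Suc n))"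
      by (rule nn_integral_law_prior) (simp, measurable)
    also have "\<dots> = (\<integral>\<^sup>+x. (\<integral>\<^sup>+y. indicator A x * mix_dens B (Suc n) (x(Suc n := y)) \<partial>ref_measure B) \<partial>obs_measure B n)"
      by (subst nn_integral_obs_Suc) (measurable, auto intro!: nn_integral_cong simp: restrict_append restrict_obs
          simp del: fun_upd_apply One_nat_def)
    also have "\<dots> = (\<integral>\<^sup>+x. ?h x * indicator A x \<partial>obs_measure B n)"
      by (intro nn_integral_cong) (auto simp: indicator_def)
    finally show "emeasure (density (obs_measure B n) ?h) A = emeasure (density (obs_measure B n) (mix_dens B n)) A"
      by (simp add: emeasure_density)
  qed simp
  then show ?thesis
    by (subst (asm) M.density_unique_iff) auto
qed

end

subsection \<open>Backward induction\<close>

context bayes_sequential_problem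
begin

section \<open>Continuation probabilities of a stopping rule\<close>

lemma cont_prob_1: "cont_prob \<psi> 1 x = 1"
  by (simp add: cont_prob_def)

lemma cont_prob_append:
  assumes "1 \<le> n" and "x \<in> space (obs_measure B n)"
  shows "cont_prob \<psi> (Suc n) (x(Suc n := y)) = cont_prob \<psi> n x * (1 - \<psi> n x)"
proof -
  have "(\<Prod>k\<in>{1..<n}. 1 - \<psi> k (restrict (x(Suc n := y)) {1..k})) = cont_prob \<psi> n x"
    unfolding cont_prob_def by (intro prod.cong) (simp_all add: restrict_append del: fun_upd_apply One_nat_def)
  with assms show ?thesis
    by (simp add: cont_prob_def[of _ "Suc n"] prod.atLeastLessThan_Suc restrict_append restrict_obs
        del: fun_upd_apply One_nat_def)
qed

context
  fixes \<psi> :: "nat \<Rightarrow> (nat \<Rightarrow> 'x) \<Rightarrow> real" and n :: nat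
  assumes \<psi>: "\<psi> \<in> stopping_rules B" and n: "1 \<le> n"
begin

lemma stopping_rule_measurable[measurable]: "\<psi> n \<in> borel_measurable (obs_measure B n)"
  using \<psi> n by (simp add: stopping_rules_def)

lemma stopping_rule_bounds:
  assumes "x \<in> space (obs_measure B n)"
  shows "0 \<le> \<psi> n x" "\<psi> n x \<le> 1"
  using \<psi> n assms by (auto simp: stopping_rules_def)

lemma cont_prob_measurable[measurable]: "cont_prob \<psi> n \<in> borel_measurable (obs_measure B n)"
  unfolding cont_prob_def[abs_def]
proof (rule borel_measurable_prod)
  fix k assume k: "k \<in> {1..<n}"
  then have "\<psi> k \<in> borel_measurable (obs_measure B k)"
    using \<psi> by (simp add: stopping_rules_def)
  moreover have "(\<lambda>x. restrict x {1..k}) \<in> obs_measure B n \<rightarrow>\<^sub>M obs_measure B k"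
    using k unfolding obs_measure_def by (intro measurable_restrict_subset) auto
  ultimately have "(\<lambda>x. \<psi> k (restrict x {1..k})) \<in> borel_measurable (obs_measure B n)"
    by (rule measurable_compose[rotated])
  then show "(\<lambda>x. 1 - \<psi> k (restrict x {1..k})) \<in> borel_measurable (obs_measure B n)"
    by simp
qed

lemma stop_prob_measurable[measurable]: "stop_prob \<psi> n \<in> borel_measurable (obs_measure B n)"
  unfolding stop_prob_def[abs_def] by measurable

lemma cont_prob_nonneg:
  assumes "x \<in> space (obs_measure B n)"
  shows "0 \<le> cont_prob \<psi> n x"
  unfolding cont_prob_def
proof (rule prod_nonneg)
  fix k assume k: "k \<in> {1..<n}"
  with assms have "restrict x {1..k} \<in> space (obs_measure B k)"
    by (intro restrict_obs_space[of k n]) auto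
  with k \<psi> show "0 \<le> 1 - \<psi> k (restrict x {1..k})"
    by (simp add: stopping_rules_def)
qed

end

end

locale bayes_sequential_cost = bayes_sequential_problem B
  for B :: "('p, 'w, 'x, 'd) sequential_problem" +
  fixes c :: real
  assumes c_pos: "0 < c"
begin

text \<open>
  \<open>loss_value d n\<close> is \<open>f\<^sup>n v\<^sub>n\<^sup>N\<close> for the horizon \<open>N = n + d\<close>; without the quotients by \<open>f\<^sup>n\<close>
  the backward recursion makes sense everywhere.
\<close>

primrec loss_value :: "nat \<Rightarrow> nat \<Rightarrow> (nat \<Rightarrow> 'x) \<Rightarrow> ennreal" where
  "loss_value 0 n x = bayes_loss B n x"
| "loss_value (Suc d) n x = min (bayes_loss B n x)
    (ennreal c * mix_dens B n x + (\<integral>\<^sup>+y. loss_value d (Suc n) (x(Suc n := y)) \<partial>ref_measure B))"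

definition next_value :: "nat \<Rightarrow> nat \<Rightarrow> (nat \<Rightarrow> 'x) \<Rightarrow> ennreal"
  where "next_value d n x = (\<integral>\<^sup>+y. loss_value d (Suc n) (x(Suc n := y)) \<partial>ref_measure B)"

text \<open>The limit in \<open>W\<^sub>n\<close> is taken as an infimum, which
  \<open>decseq_next_value\<close> justifies. It stays outside the integral over the next
  observation, so no exchange of limit and integral is built in.\<close>

definition wait_value :: "nat \<Rightarrow> (nat \<Rightarrow> 'x) \<Rightarrow> ennreal"
  where "wait_value n x = ennreal c * mix_dens B n x + (INF d. next_value d n x)"

definition limit_value :: "nat \<Rightarrow> (nat \<Rightarrow> 'x) \<Rightarrow> ennreal"
  where "limit_value n x = min (bayes_loss B n x) (wait_value n x)"

definition paid :: "nat \<Rightarrow> (nat \<Rightarrow> 'x) \<Rightarrow> ennreal"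
  where "paid n x = ennreal (c * real n) * mix_dens B n x"

definition stop_cost :: "(nat \<Rightarrow> (nat \<Rightarrow> 'x) \<Rightarrow> real) \<Rightarrow> nat \<Rightarrow> ennreal"
  where "stop_cost \<psi> n =
    (\<integral>\<^sup>+x. ennreal (stop_prob \<psi> n x) * stage_cost B c n x \<partial>obs_measure B n)"

text \<open>This is \<open>J\<^sub>n(h)\<close>. The cost of the first \<open>n\<close> observations
  is kept apart from \<open>h\<close>, which carries only the loss and future costs.\<close>

definition stopped_risk :: "(nat \<Rightarrow> (nat \<Rightarrow> 'x) \<Rightarrow> real) \<Rightarrow> nat \<Rightarrow> ((nat \<Rightarrow> 'x) \<Rightarrow> ennreal) \<Rightarrow> ennreal"
  where "stopped_risk \<psi> n h = (\<Sum>k\<in>{1..<n}. stop_cost \<psi> k) +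
    (\<integral>\<^sup>+x. ennreal (cont_prob \<psi> n x) * (paid n x + h x) \<partial>obs_measure B n)"

text \<open>The number \<open>V\<close>. No continuation probability occurs, because the first
  observation is always taken.\<close>

definition optimal_risk :: ennreal
  where "optimal_risk = (\<integral>\<^sup>+x. paid 1 x + limit_value 1 x \<partial>obs_measure B 1)"

text \<open>Null sets are those of the reference measure, against which costs are integrated;
  \<open>stage_optimal_iff\<close> passes to the mixed law.\<close>

definition stage_optimal :: "(nat \<Rightarrow> (nat \<Rightarrow> 'x) \<Rightarrow> real) \<Rightarrow> nat \<Rightarrow> bool"
  where "stage_optimal \<psi> n \<longleftrightarrow> (AE x in obs_measure B n. 0 < cont_prob \<psi> n x \<longrightarrow>
    ennreal (\<psi> n x) * bayes_loss B n x + ennreal (1 - \<psi> n x) * wait_value n x = limit_value n x)"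

lemma stage_cost_eq: "stage_cost B c n x = paid n x + bayes_loss B n x"
  by (simp add: stage_cost_def paid_def)

lemma trunc_risk_eq: "trunc_risk B c N \<psi> = stopped_risk \<psi> N (loss_value 0 N)"
  by (simp add: trunc_risk_def stopped_risk_def stop_cost_def stage_cost_eq)

lemma loss_value_Suc:
  "loss_value (Suc d) n x = min (bayes_loss B n x) (ennreal c * mix_dens B n x + next_value d n x)"
  by (simp add: next_value_def)

lemma loss_value_measurable[measurable]:
  "1 \<le> n \<Longrightarrow> loss_value d n \<in> borel_measurable (obs_measure B n)"
proof (induction d arbitrary: n)
  case 0
  then show ?case
    using bayes_loss_measurable by simp
next
  case (Suc d)
  have [measurable]: "bayes_loss B n \<in> borel_measurable (obs_measure B n)"
    "mix_dens B n \<in> borel_measurable (obs_measure B n)"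
    "loss_value d (Suc n) \<in> borel_measurable (obs_measure B (Suc n))"
    using Suc by (auto intro: bayes_loss_measurable mix_dens_measurable)
  show ?case
    by simp
qed

context
  fixes n :: nat
  assumes n: "1 \<le> n"
begin

lemma next_value_measurable[measurable]: "next_value d n \<in> borel_measurable (obs_measure B n)"
  unfolding next_value_def[abs_def]
  using loss_value_measurable[of "Suc n" d] by (intro borel_measurable_nn_integral_append) simp

lemma paid_measurable[measurable]: "paid n \<in> borel_measurable (obs_measure B n)"
  unfolding paid_def[abs_def] using mix_dens_measurable[OF n] by measurable

lemma wait_value_measurable[measurable]: "wait_value n \<in> borel_measurable (obs_measure B n)"
  unfolding wait_value_def[abs_def] using mix_dens_measurable[OF n] by measurable

lemma limit_value_measurable[measurable]: "limit_value n \<in> borel_measurable (obs_measure B n)"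
  unfolding limit_value_def[abs_def] using bayes_loss_measurable[OF n] by measurable

lemma stage_cost_measurable[measurable]: "stage_cost B c n \<in> borel_measurable (obs_measure B n)"
  unfolding stage_cost_eq[abs_def] using bayes_loss_measurable[OF n] by measurable

end

text \<open>A longer horizon only adds options: the base case holds because a minimum is below its
  first argument, the step because the recursion is monotone.\<close>

lemma loss_value_Suc_le: "loss_value (Suc d) n x \<le> loss_value d n x"
proof (induction d arbitrary: n x)
  case (Suc d)
  have "next_value (Suc d) n x \<le> next_value d n x"
    unfolding next_value_def by (intro nn_integral_mono Suc.IH)
  then show ?case
    unfolding loss_value_Suc by (intro min.mono add_mono) auto
qed simp

lemma decseq_loss_value: "decseq (\<lambda>d. loss_value d n x)"
  by (intro decseq_SucI loss_value_Suc_le)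

lemma decseq_next_value: "decseq (\<lambda>d. next_value d n x)"
  unfolding next_value_def by (intro decseq_SucI nn_integral_mono loss_value_Suc_le)

text \<open>Continuity of minimum and sum carries the recursion to the limit;
  \<open>wait_value\<close> already contains the limit of the integrals.\<close>

lemma loss_value_tendsto: "(\<lambda>d. loss_value d n x) \<longlonglongrightarrow> limit_value n x"
proof -
  have "(\<lambda>d. next_value d n x) \<longlonglongrightarrow> (INF d. next_value d n x)"
    by (intro LIMSEQ_INF decseq_next_value)
  then have "(\<lambda>d. loss_value (Suc d) n x) \<longlonglongrightarrow> limit_value n x"
    unfolding loss_value_Suc limit_value_def wait_value_def by (intro tendsto_intros)
  then show ?thesis
    by (rule LIMSEQ_imp_Suc)
qed

lemma limit_value_eq_INF: "limit_value n x = (INF d. loss_value d n x)"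
  using LIMSEQ_unique[OF loss_value_tendsto LIMSEQ_INF[OF decseq_loss_value]] .

lemma limit_value_le: "limit_value n x \<le> loss_value d n x"
  unfolding limit_value_eq_INF by (rule INF_lower) simp

lemma stopped_risk_mono:
  assumes "\<And>x. x \<in> space (obs_measure B n) \<Longrightarrow> g x \<le> h x"
  shows "stopped_risk \<psi> n g \<le> stopped_risk \<psi> n h"
  unfolding stopped_risk_def using assms by (intro add_mono nn_integral_mono mult_left_mono) auto

text \<open>Integrating out the last observation moves the end of the experiment back by one stage:
  the mass \<open>t\<^sub>n\<close> splits into a stopped and a continued portion, and consistency
  of the mixed densities prices the extra observation at \<open>c f\<^sup>n\<close>.\<close>

lemma stopped_risk_Suc:
  assumes \<psi>: "\<psi> \<in> stopping_rules B" and n: "1 \<le> n"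
    and h[measurable]: "h \<in> borel_measurable (obs_measure B (Suc n))"
  shows "stopped_risk \<psi> (Suc n) h = stopped_risk \<psi> n (\<lambda>x. ennreal (\<psi> n x) * bayes_loss B n x +
    ennreal (1 - \<psi> n x) * (ennreal c * mix_dens B n x + (\<integral>\<^sup>+y. h (x(Suc n := y)) \<partial>ref_measure B)))"
proof -
  note [measurable] = stopping_rule_measurable[OF \<psi> n] cont_prob_measurable[OF \<psi> n]
    stop_prob_measurable[OF \<psi> n] mix_dens_measurable[OF n] bayes_loss_measurable[OF n]
    stage_cost_measurable[OF n] paid_measurable[OF n]
  have [measurable]: "cont_prob \<psi> (Suc n) \<in> borel_measurable (obs_measure B (Suc n))"
    "paid (Suc n) \<in> borel_measurable (obs_measure B (Suc n))"
    "mix_dens B (Suc n) \<in> borel_measurable (obs_measure B (Suc n))"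
    by (auto intro: cont_prob_measurable[OF \<psi>] paid_measurable mix_dens_measurable)
  define H where "H x = (\<integral>\<^sup>+y. h (x(Suc n := y)) \<partial>ref_measure B)" for x
  have [measurable]: "H \<in> borel_measurable (obs_measure B n)"
    unfolding H_def[abs_def] by measurable
  \<comment> \<open>The continuation probability ignores the last coordinate and leaves the
    integral; \<open>c (n + 1)\<close> splits into \<open>c n\<close>, already paid, and
    \<open>c\<close>.\<close>
  have inner: "AE x in obs_measure B n.
      (\<integral>\<^sup>+y. ennreal (cont_prob \<psi> (Suc n) (x(Suc n := y))) * (paid (Suc n) (x(Suc n := y)) + h (x(Suc n := y))) \<partial>ref_measure B)
      = ennreal (cont_prob \<psi> n x * (1 - \<psi> n x)) * (paid n x + (ennreal c * mix_dens B n x + H x))"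
    using AE_space mix_dens_append[OF n]
  proof eventually_elim
    case (elim x)
    note [measurable] = measurable_append_const[OF elim(1)]
    have "(\<integral>\<^sup>+y. paid (Suc n) (x(Suc n := y)) \<partial>ref_measure B) = ennreal (c * real (Suc n)) * mix_dens B n x"
      unfolding paid_def elim(2)[symmetric] by (rule nn_integral_cmult) measurable
    also have "\<dots> = paid n x + ennreal c * mix_dens B n x"
      using c_pos by (simp add: paid_def ring_distribs flip: distrib_right ennreal_plus)
        (simp add: algebra_simps)
    finally show ?case
      unfolding cont_prob_append[OF n elim(1)] H_def
      by (subst nn_integral_cmult, measurable, subst nn_integral_add, measurable) (simp add: add.assoc)
  qed
  have "stop_cost \<psi> n + (\<integral>\<^sup>+x. ennreal (cont_prob \<psi> (Suc n) x) * (paid (Suc n) x + h x) \<partial>obs_measure B (Suc n))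
      = (\<integral>\<^sup>+x. ennreal (stop_prob \<psi> n x) * stage_cost B c n x \<partial>obs_measure B n)
      + (\<integral>\<^sup>+x. ennreal (cont_prob \<psi> n x * (1 - \<psi> n x)) * (paid n x + (ennreal c * mix_dens B n x + H x)) \<partial>obs_measure B n)"
    unfolding stop_cost_def
    by (subst nn_integral_obs_Suc, measurable, subst nn_integral_cong_AE[OF inner]) simp
  also have "\<dots> = (\<integral>\<^sup>+x. ennreal (stop_prob \<psi> n x) * stage_cost B c n x +
      ennreal (cont_prob \<psi> n x * (1 - \<psi> n x)) * (paid n x + (ennreal c * mix_dens B n x + H x)) \<partial>obs_measure B n)"
    by (rule nn_integral_add[symmetric]) measurable
  also have "\<dots> = (\<integral>\<^sup>+x. ennreal (cont_prob \<psi> n x) * (paid n x + (ennreal (\<psi> n x) * bayes_loss B n x +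
    ennreal (1 - \<psi> n x) * (ennreal c * mix_dens B n x + H x))) \<partial>obs_measure B n)"
  proof (rule nn_integral_cong)
    fix x assume x: "x \<in> space (obs_measure B n)"
    define p where "p = \<psi> n x"
    have p: "0 \<le> p" "p \<le> 1"
      unfolding p_def using stopping_rule_bounds[OF \<psi> n x] by auto
    \<comment> \<open>The weights add up to one, so the cost already paid can be shared between the
      branches of stopping and continuing.\<close>
    have "paid n x = (ennreal p + ennreal (1 - p)) * paid n x"
      using p by (subst ennreal_plus[symmetric]) auto
    then have eq: "paid n x + (ennreal p * u + ennreal (1 - p) * w) =
        ennreal p * (paid n x + u) + ennreal (1 - p) * (paid n x + w)" for u w
      by (simp add: distrib_left distrib_right ac_simps)
    show "ennreal (stop_prob \<psi> n x) * stage_cost B c n x +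
      ennreal (cont_prob \<psi> n x * (1 - \<psi> n x)) * (paid n x + (ennreal c * mix_dens B n x + H x)) =
      ennreal (cont_prob \<psi> n x) * (paid n x + (ennreal (\<psi> n x) * bayes_loss B n x +
        ennreal (1 - \<psi> n x) * (ennreal c * mix_dens B n x + H x)))"
      unfolding p_def[symmetric] eq stop_prob_def stage_cost_eq
      using p cont_prob_nonneg[OF \<psi> n x]
      by (simp add: ennreal_mult distrib_left mult.assoc)
  qed
  finally show ?thesis
    using n unfolding stopped_risk_def H_def by (simp add: sum.atLeastLessThan_Suc add.assoc)
qed

lemma stopped_risk_loss_value_Suc_le:
  assumes "\<psi> \<in> stopping_rules B" "1 \<le> n"
  shows "stopped_risk \<psi> n (loss_value (Suc d) n) \<le> stopped_risk \<psi> (Suc n) (loss_value d (Suc n))"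
  using stopping_rule_bounds[OF assms]
  by (subst stopped_risk_Suc[OF assms])
    (auto intro!: loss_value_measurable stopped_risk_mono min_le_convex_ennreal simp: next_value_def
      simp del: fun_upd_apply)

end

subsection \<open>The value of the problem\<close>

context bayes_sequential_problem
begin

text \<open>Pointwise, \<open>t\<^sub>n\<close> is the sum of \<open>s\<^sub>n\<close> and
  \<open>t\<^sub>n (1 - \<psi>\<^sub>n)\<close>; by consistency the latter integrates to the mass
  reaching the next stage.\<close>

lemma cont_prob_mass_step:
  assumes \<psi>: "\<psi> \<in> stopping_rules B" and n: "1 \<le> n"
  shows "(\<integral>\<^sup>+x. ennreal (stop_prob \<psi> n x) * mix_dens B n x \<partial>obs_measure B n) +
    (\<integral>\<^sup>+x. ennreal (cont_prob \<psi> (Suc n) x) * mix_dens B (Suc n) x \<partial>obs_measure B (Suc n)) =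
    (\<integral>\<^sup>+x. ennreal (cont_prob \<psi> n x) * mix_dens B n x \<partial>obs_measure B n)"
proof -
  note [measurable] = stopping_rule_measurable[OF \<psi> n] cont_prob_measurable[OF \<psi> n]
    stop_prob_measurable[OF \<psi> n] mix_dens_measurable[OF n]
  have [measurable]: "cont_prob \<psi> (Suc n) \<in> borel_measurable (obs_measure B (Suc n))"
    "mix_dens B (Suc n) \<in> borel_measurable (obs_measure B (Suc n))"
    by (auto intro: cont_prob_measurable[OF \<psi>] mix_dens_measurable)
  have inner: "AE x in obs_measure B n.
      (\<integral>\<^sup>+y. ennreal (cont_prob \<psi> (Suc n) (x(Suc n := y))) * mix_dens B (Suc n) (x(Suc n := y)) \<partial>ref_measure B)
      = ennreal (cont_prob \<psi> n x * (1 - \<psi> n x)) * mix_dens B n x"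
    using AE_space mix_dens_append[OF n]
  proof eventually_elim
    case (elim x)
    note [measurable] = measurable_append_const[OF elim(1)]
    show ?case
      unfolding cont_prob_append[OF n elim(1)] elim(2)[symmetric] by (rule nn_integral_cmult) measurable
  qed
  have "(\<integral>\<^sup>+x. ennreal (stop_prob \<psi> n x) * mix_dens B n x \<partial>obs_measure B n) +
    (\<integral>\<^sup>+x. ennreal (cont_prob \<psi> (Suc n) x) * mix_dens B (Suc n) x \<partial>obs_measure B (Suc n)) =
    (\<integral>\<^sup>+x. ennreal (stop_prob \<psi> n x) * mix_dens B n x \<partial>obs_measure B n) +
    (\<integral>\<^sup>+x. ennreal (cont_prob \<psi> n x * (1 - \<psi> n x)) * mix_dens B n x \<partial>obs_measure B n)"
    by (subst nn_integral_obs_Suc, measurable, subst nn_integral_cong_AE[OF inner]) simp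
  also have "\<dots> = (\<integral>\<^sup>+x. ennreal (stop_prob \<psi> n x) * mix_dens B n x +
      ennreal (cont_prob \<psi> n x * (1 - \<psi> n x)) * mix_dens B n x \<partial>obs_measure B n)"
    by (rule nn_integral_add[symmetric]) measurable
  also have "\<dots> = (\<integral>\<^sup>+x. ennreal (cont_prob \<psi> n x) * mix_dens B n x \<partial>obs_measure B n)"
  proof (rule nn_integral_cong)
    fix x assume x: "x \<in> space (obs_measure B n)"
    have "ennreal (stop_prob \<psi> n x) + ennreal (cont_prob \<psi> n x * (1 - \<psi> n x)) = ennreal (cont_prob \<psi> n x)"
      using stopping_rule_bounds[OF \<psi> n x] cont_prob_nonneg[OF \<psi> n x]
      by (subst ennreal_plus[symmetric]) (auto simp: stop_prob_def right_diff_distrib intro!: mult_left_le)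
    then show "ennreal (stop_prob \<psi> n x) * mix_dens B n x +
      ennreal (cont_prob \<psi> n x * (1 - \<psi> n x)) * mix_dens B n x = ennreal (cont_prob \<psi> n x) * mix_dens B n x"
      by (simp add: distrib_right[symmetric])
  qed
  finally show ?thesis .
qed

text \<open>The mass balance telescopes, starting from mass one at the first stage. As in
  \<open>mix_stop_prob\<close>, index \<open>n\<close> stands for stage
  \<open>n + 1\<close>.\<close>

lemma mix_stop_prob_eq_1:
  assumes \<psi>: "\<psi> \<in> stopping_rules B"
    and lim: "(\<lambda>n. \<integral>\<^sup>+x. ennreal (cont_prob \<psi> (Suc n) x) * mix_dens B (Suc n) x \<partial>obs_measure B (Suc n)) \<longlonglongrightarrow> 0"
  shows "mix_stop_prob B \<psi> = 1"
proof -
  define s where "s n = (\<integral>\<^sup>+x. ennreal (stop_prob \<psi> (Suc n) x) * mix_dens B (Suc n) x \<partial>obs_measure B (Suc n))" for n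
  define e where "e n = (\<integral>\<^sup>+x. ennreal (cont_prob \<psi> (Suc n) x) * mix_dens B (Suc n) x \<partial>obs_measure B (Suc n))" for n
  have "mix_stop_prob B \<psi> = (\<Sum>n. s n)"
    unfolding mix_stop_prob_def s_def
    by (intro suminf_cong nn_integral_law_prior measurable_compose[OF stop_prob_measurable[OF \<psi>]]) auto
  moreover have "(\<Sum>k<n. s k) + e n = 1" for n
  proof (induction n)
    case 0
    show ?case
      using nn_integral_mix_dens[of 1] by (simp add: e_def cont_prob_1[simplified])
  next
    case (Suc n)
    have "s n + e (Suc n) = e n"
      unfolding s_def e_def by (rule cont_prob_mass_step[OF \<psi>]) simp
    with Suc show ?case
      by (simp add: add.assoc)
  qed
  moreover have "(\<lambda>n. (\<Sum>k<n. s k) + e n) \<longlonglongrightarrow> (\<Sum>n. s n) + 0"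
    using lim unfolding e_def[symmetric] by (intro tendsto_add summable_LIMSEQ) auto
  ultimately show ?thesis
    using LIMSEQ_unique[OF tendsto_const[of "1::ennreal"]] by simp
qed

end

section \<open>Lower bound, attainment and the case of equality\<close>

context bayes_sequential_cost
begin

lemma stopped_risk_1: "stopped_risk \<psi> 1 h = (\<integral>\<^sup>+x. paid 1 x + h x \<partial>obs_measure B 1)"
  by (simp add: stopped_risk_def cont_prob_1[simplified])

text \<open>Stopping after one observation costs \<open>c\<close> plus the integral of
  \<open>l\<^sub>1\<close>, which is finite by assumption.\<close>

lemma optimal_risk_finite: "optimal_risk < top"
proof -
  note [measurable] = paid_measurable[of 1] bayes_loss_measurable[of 1] mix_dens_measurable[of 1]
  have "optimal_risk \<le> (\<integral>\<^sup>+x. paid 1 x + bayes_loss B 1 x \<partial>obs_measure B 1)"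
    unfolding optimal_risk_def limit_value_def by (intro nn_integral_mono add_mono) auto
  also have "\<dots> = ennreal c + (\<integral>\<^sup>+x. bayes_loss B 1 x \<partial>obs_measure B 1)"
    using nn_integral_mix_dens[of 1]
    by (subst nn_integral_add) (auto simp: paid_def[abs_def] nn_integral_cmult)
  also have "\<dots> < top"
    using bayes_loss_integrable by simp
  finally show ?thesis .
qed

context
  fixes \<psi> :: "nat \<Rightarrow> (nat \<Rightarrow> 'x) \<Rightarrow> real"
  assumes \<psi>: "\<psi> \<in> stopping_rules B"
begin

text \<open>Iterates \<open>stopped_risk_loss_value_Suc_le\<close> with the horizon
  \<open>n + d\<close> held fixed.\<close>

lemma stopped_risk_loss_value_le_trunc_risk:
  "1 \<le> n \<Longrightarrow> stopped_risk \<psi> n (loss_value d n) \<le> trunc_risk B c (n + d) \<psi>"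
proof (induction d arbitrary: n)
  case 0
  then show ?case by (simp only: trunc_risk_eq add_0_right)
next
  case (Suc d)
  have "stopped_risk \<psi> n (loss_value (Suc d) n) \<le> stopped_risk \<psi> (Suc n) (loss_value d (Suc n))"
    by (rule stopped_risk_loss_value_Suc_le[OF \<psi> Suc.prems])
  also have "\<dots> \<le> trunc_risk B c (Suc n + d) \<psi>"
    by (rule Suc.IH) simp
  finally show ?case
    unfolding add_Suc_shift .
qed

text \<open>Moving forward one stage shortens the remaining horizon, so \<open>d\<close> varies in
  the induction. For \<open>d = 0\<close> the right-hand side is a truncated risk.\<close>

lemma optimal_risk_le_stopped_risk: "optimal_risk \<le> stopped_risk \<psi> (Suc m) (loss_value d (Suc m))"
proof (induction m arbitrary: d)
  case 0
  show ?case
    unfolding One_nat_def[symmetric] stopped_risk_1 optimal_risk_def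
    by (intro nn_integral_mono add_mono limit_value_le) auto
next
  case (Suc m)
  show ?case
    by (rule order_trans[OF Suc.IH stopped_risk_loss_value_Suc_le[OF \<psi>]]) simp
qed

lemma optimal_risk_le_risk:
  assumes "truncatable B c"
  shows "optimal_risk \<le> risk B c \<psi>"
proof (rule LIMSEQ_le_const)
  show "(\<lambda>N. trunc_risk B c N \<psi>) \<longlonglongrightarrow> risk B c \<psi>"
    using assms \<psi> by (simp add: truncatable_def)
  show "\<exists>N. \<forall>n\<ge>N. optimal_risk \<le> trunc_risk B c n \<psi>"
  proof (intro exI allI impI)
    fix n :: nat assume "1 \<le> n"
    then show "optimal_risk \<le> trunc_risk B c n \<psi>"
      using optimal_risk_le_stopped_risk[of "n - 1" 0] by (simp add: trunc_risk_eq)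
  qed
qed

text \<open>Only the easy direction is needed: the integral of the limit value is at most the
  infimum of the integrals, which requires no integrability.\<close>

lemma stopped_risk_limit_value_Suc_le:
  assumes n: "1 \<le> n" and opt: "stage_optimal \<psi> n"
  shows "stopped_risk \<psi> (Suc n) (limit_value (Suc n)) \<le> stopped_risk \<psi> n (limit_value n)"
proof -
  have "AE x in obs_measure B n. ennreal (cont_prob \<psi> n x) * (paid n x + (ennreal (\<psi> n x) * bayes_loss B n x +
      ennreal (1 - \<psi> n x) * (ennreal c * mix_dens B n x +
        (\<integral>\<^sup>+y. limit_value (Suc n) (x(Suc n := y)) \<partial>ref_measure B))))
      \<le> ennreal (cont_prob \<psi> n x) * (paid n x + limit_value n x)"
    using opt[unfolded stage_optimal_def]
  proof eventually_elim
    case (elim x)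
    show ?case
    proof (cases "0 < cont_prob \<psi> n x")
      case True
      have "(\<integral>\<^sup>+y. limit_value (Suc n) (x(Suc n := y)) \<partial>ref_measure B) \<le> (INF d. next_value d n x)"
        unfolding next_value_def by (intro INF_greatest nn_integral_mono limit_value_le)
      with elim True show ?thesis
        by (auto simp flip: elim simp: wait_value_def intro!: mult_left_mono add_mono)
    qed (simp add: ennreal_neg)
  qed
  then show ?thesis
    using n unfolding stopped_risk_Suc[OF \<psi> n limit_value_measurable[OF le_add1[of 1 n, unfolded plus_1_eq_Suc]]]
    unfolding stopped_risk_def by (intro add_mono nn_integral_mono_AE) auto
qed

lemma stopped_risk_limit_value_le:
  assumes "\<And>n. 1 \<le> n \<Longrightarrow> stage_optimal \<psi> n"
  shows "stopped_risk \<psi> (Suc m) (limit_value (Suc m)) \<le> optimal_risk"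
proof (induction m)
  case 0
  show ?case
    unfolding One_nat_def[symmetric] stopped_risk_1 optimal_risk_def ..
next
  case (Suc m)
  show ?case
    by (rule order_trans[OF stopped_risk_limit_value_Suc_le Suc]) (auto intro: assms)
qed

text \<open>The bound on \<open>J\<^sub>n(V\<^sub>n)\<close> is used twice: its sampling cost forces
  stopping almost surely, so that \<open>risk\<close> is the series, and its accumulated stopping
  costs bound the partial sums.\<close>

lemma risk_le_optimal_risk:
  assumes "\<And>n. 1 \<le> n \<Longrightarrow> stage_optimal \<psi> n"
  shows "risk B c \<psi> \<le> optimal_risk"
proof -
  define e where "e n = (\<integral>\<^sup>+x. ennreal (cont_prob \<psi> (Suc n) x) * mix_dens B (Suc n) x \<partial>obs_measure B (Suc n))" for n
  have "ennreal (c * real (Suc n)) * e n \<le> optimal_risk" for n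
  proof -
    note [measurable] = cont_prob_measurable[OF \<psi>, of "Suc n"] mix_dens_measurable[of "Suc n"]
    have "ennreal (c * real (Suc n)) * e n =
        (\<integral>\<^sup>+x. ennreal (c * real (Suc n)) * (ennreal (cont_prob \<psi> (Suc n) x) * mix_dens B (Suc n) x) \<partial>obs_measure B (Suc n))"
      unfolding e_def by (rule nn_integral_cmult[symmetric]) measurable
    also have "\<dots> \<le> (\<integral>\<^sup>+x. ennreal (cont_prob \<psi> (Suc n) x) * (paid (Suc n) x + limit_value (Suc n) x) \<partial>obs_measure B (Suc n))"
      by (intro nn_integral_mono) (simp add: paid_def distrib_left mult.left_commute del: of_nat_Suc)
    also have "\<dots> \<le> stopped_risk \<psi> (Suc n) (limit_value (Suc n))"
      unfolding stopped_risk_def by simp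
    also have "\<dots> \<le> optimal_risk"
      by (rule stopped_risk_limit_value_le[OF assms])
    finally show ?thesis .
  qed
  then have bound: "ennreal (c * real (Suc n)) * e n \<le> optimal_risk" for n .
  \<comment> \<open>The division by \<open>c (n + 1)\<close> is done in the reals; an infinite
    \<open>e n\<close> would contradict the finite bound.\<close>
  have e_le: "e n \<le> ennreal (enn2real optimal_risk / c * inverse (real (Suc n)))" for n
  proof -
    obtain r where r: "0 \<le> r" "optimal_risk = ennreal r"
      using optimal_risk_finite by (cases optimal_risk) auto
    have pos: "0 < c * real (Suc n)"
      using c_pos by simp
    obtain s where s: "0 \<le> s" "e n = ennreal s"
      using bound[of n] pos r by (cases "e n") (auto simp: ennreal_mult_top top_unique simp del: of_nat_Suc split: if_splits)
    have "c * real (Suc n) * s \<le> r"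
      using bound[of n] pos r s by (simp add: ennreal_mult[symmetric] del: of_nat_Suc)
    then show ?thesis
      using pos c_pos r s by (simp add: field_simps del: of_nat_Suc)
  qed
  have "(\<lambda>n. ennreal (enn2real optimal_risk / c * inverse (real (Suc n)))) \<longlonglongrightarrow> ennreal (enn2real optimal_risk / c * 0)"
    by (intro tendsto_ennrealI tendsto_mult_left LIMSEQ_inverse_real_of_nat)
  then have "e \<longlonglongrightarrow> 0"
    by (intro tendsto_sandwich[OF _ _ tendsto_const, of 0 e _ "\<lambda>n. ennreal (enn2real optimal_risk / c * inverse (real (Suc n)))"])
      (use e_le in auto)
  then have "mix_stop_prob B \<psi> = 1"
    unfolding e_def by (rule mix_stop_prob_eq_1[OF \<psi>])
  then have "risk B c \<psi> = (\<Sum>n. stop_cost \<psi> (Suc n))"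
    by (simp add: risk_def stop_cost_def)
  also have "\<dots> \<le> optimal_risk"
  proof (rule suminf_le_const)
    fix n
    have "(\<Sum>k<n. stop_cost \<psi> (Suc k)) = (\<Sum>k\<in>{1..<Suc n}. stop_cost \<psi> k)"
      by (simp only: One_nat_def sum.shift_bounds_Suc_ivl atLeast0LessThan)
    also have "\<dots> \<le> stopped_risk \<psi> (Suc n) (limit_value (Suc n))"
      unfolding stopped_risk_def by simp
    also have "\<dots> \<le> optimal_risk"
      by (rule stopped_risk_limit_value_le[OF assms])
    finally show "(\<Sum>k<n. stop_cost \<psi> (Suc k)) \<le> optimal_risk" .
  qed simp
  finally show ?thesis .
qed

text \<open>\<open>optimal_risk\<close> is squeezed between the cost with the minimum at stage
  \<open>n\<close> and the cost with the convex combination that \<open>\<psi>\<close> realises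
  there.\<close>

lemma stage_optimal_if_risk_eq:
  assumes trunc: "truncatable B c" and opt: "risk B c \<psi> = optimal_risk" and n: "1 \<le> n"
  shows "stage_optimal \<psi> n"
proof -
  note [measurable] = stopping_rule_measurable[OF \<psi> n] cont_prob_measurable[OF \<psi> n]
    bayes_loss_measurable[OF n] paid_measurable[OF n] limit_value_measurable[OF n]
    wait_value_measurable[OF n] loss_value_measurable[OF n]
  define step where "step w x = ennreal (\<psi> n x) * bayes_loss B n x + ennreal (1 - \<psi> n x) * w x" for w and x :: "nat \<Rightarrow> 'x"
  have [measurable]: "step (wait_value n) \<in> borel_measurable (obs_measure B n)"
    unfolding step_def[abs_def] by measurable
  define P where "P = (\<Sum>k\<in>{1..<n}. stop_cost \<psi> k)"
  define Q where "Q h = (\<integral>\<^sup>+x. ennreal (cont_prob \<psi> n x) * (paid n x + h x) \<partial>obs_measure B n)" for h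
  have stopped_risk_eq: "stopped_risk \<psi> n h = P + Q h" for h
    by (simp add: stopped_risk_def P_def Q_def)
  have lim: "(\<lambda>N. trunc_risk B c N \<psi>) \<longlonglongrightarrow> optimal_risk"
    using trunc \<psi> opt by (auto simp: truncatable_def)

  \<comment> \<open>Lowering the continuation value to \<open>W\<^sub>n\<close> preserves the bound
    for every horizon; \<open>upper\<close> follows in the limit.\<close>
  have "P + Q (step (wait_value n)) \<le> trunc_risk B c (Suc n + d) \<psi>" for d
  proof -
    have "wait_value n x \<le> ennreal c * mix_dens B n x + next_value d n x" for x
      unfolding wait_value_def by (intro add_mono INF_lower) auto
    then have "stopped_risk \<psi> n (step (wait_value n)) \<le> stopped_risk \<psi> (Suc n) (loss_value d (Suc n))"
      using n unfolding stopped_risk_Suc[OF \<psi> n loss_value_measurable[OF le_add1[of 1 n, unfolded plus_1_eq_Suc]]]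
      by (auto intro!: stopped_risk_mono add_mono mult_left_mono simp: step_def next_value_def)
    also have "\<dots> \<le> trunc_risk B c (Suc n + d) \<psi>"
      by (rule stopped_risk_loss_value_le_trunc_risk) simp
    finally show ?thesis
      by (simp add: stopped_risk_eq)
  qed
  then have upper: "P + Q (step (wait_value n)) \<le> optimal_risk"
    by (intro LIMSEQ_le_const[OF lim] exI[of _ "Suc n"]) (metis le_add_diff_inverse)

  \<comment> \<open>Monotone convergence for decreasing sequences needs one finite integral. The
    truncated risks have a finite limit, so some horizon \<open>N\<close> supplies it, together with
    finiteness of \<open>P\<close>.\<close>
  have "eventually (\<lambda>N. trunc_risk B c N \<psi> < top) sequentially"
    using order_tendstoD(2)[OF lim optimal_risk_finite] .
  then have "eventually (\<lambda>N. n \<le> N \<and> trunc_risk B c N \<psi> < top) sequentially"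
    using eventually_ge_at_top[of n] by eventually_elim simp
  then obtain N where N: "n \<le> N" "trunc_risk B c N \<psi> < top"
    by (auto dest: eventually_happens)
  have "P + Q (loss_value (N - n) n) \<le> trunc_risk B c N \<psi>"
    using stopped_risk_loss_value_le_trunc_risk[OF n, of "N - n"] N by (simp add: stopped_risk_eq)
  then have "P + Q (loss_value (N - n) n) < top"
    using N(2) by (rule le_less_trans)
  then have fin: "P < top" "Q (loss_value (N - n) n) < top"
    by simp_all
  have "Q (limit_value n) = (\<integral>\<^sup>+x. (INF d. ennreal (cont_prob \<psi> n x) * (paid n x + loss_value d n x)) \<partial>obs_measure B n)"
    unfolding Q_def
  proof (rule nn_integral_cong)
    fix x
    have "(\<lambda>d. ennreal (cont_prob \<psi> n x) * (paid n x + loss_value d n x)) \<longlonglongrightarrow>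
        ennreal (cont_prob \<psi> n x) * (paid n x + limit_value n x)"
      by (intro ennreal_tendsto_cmult tendsto_add tendsto_const loss_value_tendsto) simp
    moreover have "decseq (\<lambda>d. ennreal (cont_prob \<psi> n x) * (paid n x + loss_value d n x))"
      by (intro decseq_SucI mult_left_mono add_left_mono loss_value_Suc_le) simp
    ultimately show "ennreal (cont_prob \<psi> n x) * (paid n x + limit_value n x) =
        (INF d. ennreal (cont_prob \<psi> n x) * (paid n x + loss_value d n x))"
      using LIMSEQ_INF LIMSEQ_unique by blast
  qed
  also have "\<dots> = (INF d. Q (loss_value d n))"
    unfolding Q_def
  proof (rule nn_integral_monotone_convergence_INF_decseq)
    show "decseq (\<lambda>d x. ennreal (cont_prob \<psi> n x) * (paid n x + loss_value d n x))"
      by (intro decseq_SucI le_funI mult_left_mono add_left_mono loss_value_Suc_le) simp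
    show "(\<integral>\<^sup>+x. ennreal (cont_prob \<psi> n x) * (paid n x + loss_value (N - n) n x) \<partial>obs_measure B n) < \<infinity>"
      using fin(2) by (simp add: Q_def)
  qed measurable
  finally have "(\<lambda>d. P + Q (loss_value d n)) \<longlonglongrightarrow> P + Q (limit_value n)"
    by (auto intro!: tendsto_add tendsto_const LIMSEQ_INF decseq_SucI nn_integral_mono mult_left_mono
        add_left_mono loss_value_Suc_le simp: Q_def)
  moreover have "optimal_risk \<le> P + Q (loss_value d n)" for d
    using optimal_risk_le_stopped_risk[of "n - 1" d] n by (simp add: stopped_risk_eq)
  ultimately have lower: "optimal_risk \<le> P + Q (limit_value n)"
    by (intro LIMSEQ_le_const) auto

  have "Q (step (wait_value n)) \<le> Q (limit_value n)"
    using order_trans[OF upper lower] fin(1) by (auto simp: ennreal_add_left_cancel_le)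
  moreover have "Q (limit_value n) < \<infinity>"
    using fin(2) by (auto simp: Q_def intro!: le_less_trans[OF _ fin(2)] nn_integral_mono mult_left_mono add_left_mono limit_value_le)
  moreover have "limit_value n x \<le> step (wait_value n) x" if "x \<in> space (obs_measure B n)" for x
    unfolding limit_value_def step_def
    by (rule min_le_convex_ennreal) (use stopping_rule_bounds[OF \<psi> n that] in auto)
  ultimately have "AE x in obs_measure B n. ennreal (cont_prob \<psi> n x) * (paid n x + step (wait_value n) x) =
      ennreal (cont_prob \<psi> n x) * (paid n x + limit_value n x)"
    unfolding Q_def
    by (intro AE_eq_of_nn_integral_le) (auto intro!: AE_I2 mult_left_mono add_left_mono)
  then show ?thesis
    unfolding stage_optimal_def step_def[symmetric]
    using AE_mix_dens_finite[OF n]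
  proof eventually_elim
    case (elim x)
    \<comment> \<open>Finiteness allows the paid cost to be cancelled from the equality of
      integrands.\<close>
    have "paid n x < top"
      using elim(2) by (simp add: paid_def ennreal_mult_less_top)
    with elim(1) show ?case
      by (auto simp: ennreal_mult_cancel_left ennreal_eq_0_iff ennreal_add_left_cancel)
  qed
qed

end

text \<open>The witness that \<open>V\<close> is attained. Comparing \<open>l\<^sub>n\<close> with
  \<open>W\<^sub>n\<close> avoids quotients, so optimality holds at every point; at ties either
  value would do.\<close>

definition earliest_optimal_rule :: "nat \<Rightarrow> (nat \<Rightarrow> 'x) \<Rightarrow> real"
  where "earliest_optimal_rule n x = (if bayes_loss B n x \<le> wait_value n x then 1 else 0)"

lemma earliest_optimal_rule: "earliest_optimal_rule \<in> stopping_rules B"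
  unfolding stopping_rules_def
proof (intro CollectI allI impI conjI ballI)
  fix n :: nat assume n: "1 \<le> n"
  note [measurable] = bayes_loss_measurable[OF n] wait_value_measurable[OF n]
  show "earliest_optimal_rule n \<in> borel_measurable (obs_measure B n)"
    unfolding earliest_optimal_rule_def[abs_def] by measurable
qed (auto simp: earliest_optimal_rule_def)

lemma stage_optimal_earliest_optimal_rule: "stage_optimal earliest_optimal_rule n"
  unfolding stage_optimal_def by (auto simp: earliest_optimal_rule_def limit_value_def min_def)

text \<open>The lower bound for all rules and its attainment by \<open>earliest_optimal_rule\<close>
  identify the infimum as \<open>optimal_risk\<close>.\<close>

theorem risk_minimal_iff:
  assumes trunc: "truncatable B c" and \<psi>: "\<psi> \<in> stopping_rules B"
  shows "risk B c \<psi> = (INF \<psi>'\<in>stopping_rules B. risk B c \<psi>') \<longleftrightarrow> (\<forall>n\<ge>1. stage_optimal \<psi> n)"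
proof -
  have "(INF \<psi>'\<in>stopping_rules B. risk B c \<psi>') = optimal_risk"
  proof (rule antisym)
    show "(INF \<psi>'\<in>stopping_rules B. risk B c \<psi>') \<le> optimal_risk"
      by (rule INF_lower2[OF earliest_optimal_rule])
        (rule risk_le_optimal_risk[OF earliest_optimal_rule stage_optimal_earliest_optimal_rule])
  qed (intro INF_greatest optimal_risk_le_risk trunc)
  moreover have "risk B c \<psi> = optimal_risk \<longleftrightarrow> (\<forall>n\<ge>1. stage_optimal \<psi> n)"
    using stage_optimal_if_risk_eq[OF \<psi> trunc] risk_le_optimal_risk[OF \<psi>] optimal_risk_le_risk[OF \<psi> trunc]
    by (auto intro: antisym)
  ultimately show ?thesis by simp
qed

end

subsection \<open>Posterior form of the optimality condition\<close>

context bayes_sequential_cost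
begin

context
  fixes n :: nat
  assumes n: "1 \<le> n"
begin

lemma mix_dens_times_post_risk:
  assumes "x \<in> space (obs_measure B n)" "mix_dens B n x < top"
  shows "mix_dens B n x * post_risk B n x = bayes_loss B n x"
  using assms mix_dens_eq_0_imp_bayes_loss_eq_0[OF n assms(1)]
  by (cases "mix_dens B n x = 0")
    (auto simp: post_risk_def ennreal_times_divide mult.commute[of "mix_dens B n x"] ennreal_mult_divide_eq)

text \<open>Almost every section inherits the hypothesis, and \<open>mix_dens B n x\<close> is
  constant in the appended value.\<close>

lemma cond_exp_next_eq:
  assumes eq: "AE z in obs_measure B (Suc n). mix_dens B (Suc n) z * g z = h z"
    and [measurable]: "h \<in> borel_measurable (obs_measure B (Suc n))"
  shows "AE x in obs_measure B n.
    cond_exp_next B n g x = (\<integral>\<^sup>+y. h (x(Suc n := y)) \<partial>ref_measure B) / mix_dens B n x"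
  using AE_space AE_obs_Suc[OF eq]
proof eventually_elim
  case (elim x)
  note [measurable] = measurable_append_const[OF elim(1)]
  have "cond_exp_next B n g x = (\<integral>\<^sup>+y. h (x(Suc n := y)) / mix_dens B n x \<partial>ref_measure B)"
    unfolding cond_exp_next_def by (rule nn_integral_cong_AE) (use elim(2) in eventually_elim, simp add: mult.commute)
  also have "\<dots> = (\<integral>\<^sup>+y. h (x(Suc n := y)) \<partial>ref_measure B) / mix_dens B n x"
    by (rule nn_integral_divide) measurable
  finally show ?case .
qed

end

text \<open>Links the posterior recursion to the one without denominators. The base case also covers
  \<open>n > N\<close>, where both sides reduce to the Bayes loss.\<close>

lemma mix_dens_times_trunc_value:
  "1 \<le> n \<Longrightarrow> AE x in obs_measure B n. mix_dens B n x * trunc_value B c N n x = loss_value (N - n) n x"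
proof (induction "N - n" arbitrary: n)
  case 0
  show ?case
    using AE_space AE_mix_dens_finite[OF 0(2)]
    by eventually_elim (use 0 in \<open>simp add: trunc_value.simps[of B c N n] mix_dens_times_post_risk\<close>)
next
  case (Suc d)
  from Suc.hyps(2) have d: "d = N - Suc n" "n < N" by auto
  have IH: "AE z in obs_measure B (Suc n). mix_dens B (Suc n) z * trunc_value B c N (Suc n) z = loss_value d (Suc n) z"
    using Suc.hyps(1)[of "Suc n"] d by simp
  have "AE x in obs_measure B n. cond_exp_next B n (trunc_value B c N (Suc n)) x = next_value d n x / mix_dens B n x"
    unfolding next_value_def by (intro cond_exp_next_eq Suc.prems IH loss_value_measurable) simp
  then show ?case
    using AE_space AE_mix_dens_finite[OF Suc.prems]
  proof eventually_elim
    case (elim x)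
    define f where "f = mix_dens B n x"
    have f: "f < top" using elim by (simp add: f_def)
    have "f * trunc_value B c N n x = f * min (post_risk B n x) (ennreal c + next_value d n x / f)"
      using d elim by (simp add: trunc_value.simps[of B c N n] f_def)
    also have "\<dots> = min (f * post_risk B n x) (f * (ennreal c + next_value d n x / f))"
      by (auto simp: min_def mult_left_mono intro!: antisym mult_left_mono)
    also have "f * post_risk B n x = bayes_loss B n x"
      using mix_dens_times_post_risk[OF Suc.prems] elim by (simp add: f_def)
    \<comment> \<open>Cancelling \<open>f\<close> needs \<open>f\<close> nonzero; otherwise the
      Bayes loss vanishes and both minima are zero.\<close>
    also have "min (bayes_loss B n x) (f * (ennreal c + next_value d n x / f)) = loss_value (Suc d) n x"
    proof (cases "f = 0")
      case True
      then show ?thesis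
        using mix_dens_eq_0_imp_bayes_loss_eq_0[OF Suc.prems elim(2)] by (simp add: f_def min_absorb1)
    next
      case False
      then have "f * (next_value d n x / f) = next_value d n x"
        using f by (simp add: ennreal_times_divide mult.commute[of f] ennreal_mult_divide_eq)
      then show ?thesis
        unfolding loss_value_Suc by (simp add: distrib_left mult.commute f_def)
    qed
    finally show ?case
      using Suc.hyps(2) by (simp only: f_def)
  qed
qed

lemma cont_value_eq:
  assumes n: "1 \<le> n"
  shows "AE x in obs_measure B n. 0 < mix_dens B n x \<longrightarrow> cont_value B c n x = wait_value n x / mix_dens B n x"
proof -
  \<comment> \<open>There are countably many horizons, so one exceptional null set serves them
    all.\<close>
  have "AE x in obs_measure B n. \<forall>N. cond_exp_next B n (trunc_value B c N (Suc n)) x =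
      next_value (N - Suc n) n x / mix_dens B n x"
    unfolding next_value_def AE_all_countable
    by (intro allI cond_exp_next_eq n mix_dens_times_trunc_value loss_value_measurable) simp_all
  then show ?thesis
    using AE_mix_dens_finite[OF n]
  proof (eventually_elim, intro impI)
    fix x
    define f where "f = mix_dens B n x"
    assume cond: "\<forall>N. cond_exp_next B n (trunc_value B c N (Suc n)) x = next_value (N - Suc n) n x / mix_dens B n x"
      and "mix_dens B n x < top" "0 < mix_dens B n x"
    then have f: "f < top" "f \<noteq> 0" by (auto simp: f_def)
    \<comment> \<open>Subtraction yields zero for the finitely many \<open>N \<le> n\<close>, which
      do not affect the limit.\<close>
    have "(\<lambda>N. next_value (N - Suc n) n x) \<longlonglongrightarrow> (INF d. next_value d n x)"
      by (rule filterlim_compose[OF LIMSEQ_INF[OF decseq_next_value] filterlim_minus_const_nat_at_top])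
    \<comment> \<open>The factor \<open>inverse f\<close> is finite because \<open>f\<close> is
      nonzero, so multiplication by it is continuous.\<close>
    then have "(\<lambda>N. ennreal c + inverse f * next_value (N - Suc n) n x) \<longlonglongrightarrow>
        ennreal c + inverse f * (INF d. next_value d n x)"
      using f by (intro tendsto_add tendsto_const ennreal_tendsto_cmult) (auto simp: top.not_eq_extremum[symmetric])
    then have "(\<lambda>N. trunc_cont_value B c N n x) \<longlonglongrightarrow> ennreal c + inverse f * (INF d. next_value d n x)"
      using cond by (simp add: trunc_cont_value_def f_def divide_ennreal_def mult.commute)
    then have "cont_value B c n x = ennreal c + inverse f * (INF d. next_value d n x)"
      unfolding cont_value_def by (rule limI)
    also have "\<dots> = wait_value n x / f"
      using f by (simp add: wait_value_def f_def[symmetric] add_divide_distrib_ennreal ennreal_mult_divide_eq)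
        (simp add: divide_ennreal_def mult.commute)
    finally show "cont_value B c n x = wait_value n x / mix_dens B n x"
      by (simp add: f_def)
  qed
qed

text \<open>By consistency the next density vanishes for almost every appended value, hence so does
  the next Bayes loss, and the term \<open>d = 0\<close> already makes the infimum zero.\<close>

lemma wait_value_eq_0:
  assumes n: "1 \<le> n"
  shows "AE x in obs_measure B n. mix_dens B n x = 0 \<longrightarrow> wait_value n x = 0"
  using AE_space mix_dens_append[OF n]
proof (eventually_elim, intro impI)
  fix x
  assume x: "x \<in> space (obs_measure B n)" and 0: "mix_dens B n x = 0"
    and "(\<integral>\<^sup>+y. mix_dens B (Suc n) (x(Suc n := y)) \<partial>ref_measure B) = mix_dens B n x"
  note [measurable] = measurable_append_const[OF x]
  have [measurable]: "mix_dens B (Suc n) \<in> borel_measurable (obs_measure B (Suc n))"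
    by (rule mix_dens_measurable) simp
  from 0 \<open>_ = mix_dens B n x\<close>
  have "AE y in ref_measure B. mix_dens B (Suc n) (x(Suc n := y)) = 0"
    by (simp add: nn_integral_0_iff_AE)
  then have "AE y in ref_measure B. loss_value 0 (Suc n) (x(Suc n := y)) = 0"
    using AE_space
  proof eventually_elim
    case (elim y)
    then show ?case
      using mix_dens_eq_0_imp_bayes_loss_eq_0[of "Suc n"] measurable_space[OF measurable_append_const[OF x]]
      by simp
  qed
  then have "next_value 0 n x = 0"
    unfolding next_value_def by (simp add: nn_integral_cong_AE)
  then have "(INF d. next_value d n x) = 0"
    by (metis INF_lower UNIV_I le_zero_eq)
  with 0 show "wait_value n x = 0"
    by (simp add: wait_value_def)
qed

text \<open>Where the mixed density is positive, dividing by it preserves comparisons; where it is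
  zero, one side reads \<open>0 = 0\<close> and the other is vacuous.\<close>

lemma stage_optimal_iff:
  assumes \<psi>: "\<psi> \<in> stopping_rules B" and n: "1 \<le> n"
  shows "stage_optimal \<psi> n \<longleftrightarrow> (AE x in mix_law B n. x \<in> cont_set B \<psi> n \<longrightarrow>
      indicat_real {y. post_risk B n y < cont_value B c n y} x \<le> \<psi> n x \<and>
      \<psi> n x \<le> indicat_real {y. post_risk B n y \<le> cont_value B c n y} x)"
  unfolding stage_optimal_def mix_law_def
proof (subst AE_density, rule mix_dens_measurable[OF n], rule eventually_subst)
  show "AE x in obs_measure B n.
    (0 < cont_prob \<psi> n x \<longrightarrow>
      ennreal (\<psi> n x) * bayes_loss B n x + ennreal (1 - \<psi> n x) * wait_value n x = limit_value n x) =
    (0 < mix_dens B n x \<longrightarrow> x \<in> cont_set B \<psi> n \<longrightarrow>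
      indicat_real {y. post_risk B n y < cont_value B c n y} x \<le> \<psi> n x \<and>
      \<psi> n x \<le> indicat_real {y. post_risk B n y \<le> cont_value B c n y} x)"
    using AE_space AE_mix_dens_finite[OF n] cont_value_eq[OF n] wait_value_eq_0[OF n]
  proof eventually_elim
    case (elim x)
    note p = stopping_rule_bounds[OF \<psi> n elim(1)]
    show ?case
    proof (cases "mix_dens B n x = 0")
      case True
      then show ?thesis
        using elim mix_dens_eq_0_imp_bayes_loss_eq_0[OF n elim(1)] by (simp add: limit_value_def)
    next
      case False
      have less: "a / mix_dens B n x < b / mix_dens B n x \<longleftrightarrow> a < b" for a b
        using False elim(2)
        by (simp add: divide_less_ennreal ennreal_divide_times ennreal_mult_divide_eq)
      show ?thesis
        unfolding indicator_bounds_iff[OF p] limit_value_def convex_eq_min_ennreal_iff[OF p]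
        using False elim by (simp add: cont_set_def post_risk_def less zero_less_iff_neq_zero)
    qed
  qed
qed

end

theorem theorem6:
  fixes B :: "('p, 'w, 'x, 'd) sequential_problem"
    and c :: real
    and \<psi> :: "nat \<Rightarrow> (nat \<Rightarrow> 'x) \<Rightarrow> real"
  assumes "bayes_sequential_problem B"
    and "c > 0"
    and "truncatable B c"
    and "\<psi> \<in> stopping_rules B"
  shows "risk B c \<psi> = (INF \<psi>'\<in>stopping_rules B. risk B c \<psi>') \<longleftrightarrow>
    (\<forall>n\<ge>1. AE x in mix_law B n. x \<in> cont_set B \<psi> n \<longrightarrow>
      indicat_real {y. post_risk B n y < cont_value B c n y} x \<le> \<psi> n x \<and>
      \<psi> n x \<le> indicat_real {y. post_risk B n y \<le> cont_value B c n y} x)"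
proof -
  interpret bayes_sequential_cost B c
    using assms by (simp add: bayes_sequential_cost_def bayes_sequential_cost_axioms_def)
  show ?thesis
    using risk_minimal_iff[OF assms(3,4)] stage_optimal_iff[OF assms(4)] by simp
qed

end
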